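(* For every integer $m\ge3$ there exists $s_m\in[0,4)$ such that for all $s$ with $s_m\le s<4$, $$c_m(s)=2m\int_0^\infty[\kappa_{mm}(r)-1]\,r^{2m-1-s}\,dr>0.$$
   Context: For $r>0$ and $v=e^{-r^2}$, $$\kappa_{mm}(r)=\frac{m(1-v^{m+1})(1-v)+r^2(2m+2)(v^{m+1}-v)+r^4\left[v^{m+1}+v^m+((m+1)v+1)\frac{v^m-v}{v-1}\right]}{m(1-v)^{m+2}}.$$ *)

theory Defs
  imports "HOL-Analysis.Analysis"
begin

definition kappa_mm :: "nat \<Rightarrow> real \<Rightarrow> real" where
  "kappa_mm m r = (let v = exp (- (r^2)) in
     (real m * (1 - v^(m+1)) * (1 - v)
      + r^2 * (2 * real m + 2) * (v^(m+1) - v)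
      + r^4 * (v^(m+1) + v^m + ((real m + 1) * v + 1) * ((v^m - v) / (v - 1))))
     / (real m * (1 - v)^(m+2)))"

(* For a non-integrable integrand the Bochner integral is 0, so 0 < riesz_coeff m s
   also asserts that the integral converges absolutely. *)
definition riesz_coeff :: "nat \<Rightarrow> real \<Rightarrow> real" where
  "riesz_coeff m s =
     2 * real m * (LINT r:{0<..}|lborel. (kappa_mm m r - 1) * r powr (2 * real m - 1 - s))"

end

theory Submission
  imports Defs
begin

text \<open>
  Expanding at the origin gives \<open>\<kappa>\<^sub>m\<^sub>m(r) \<sim> (m + 1) / 4 * r\<^bsup>4 - 2m\<^esup>\<close>, so for \<open>m \<ge> 3\<close> the
  integrand behaves like \<open>(m + 1) / 4 * r\<^bsup>3 - s\<^esup>\<close>, the term \<open>-1\<close> being of lower order. Hence the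
  integral over \<open>(0, d]\<close> is at least a positive multiple of \<open>1 / (4 - s)\<close>, which tends to infinity
  as \<open>s\<close> increases to 4, while \<open>\<kappa>\<^sub>m\<^sub>m - 1\<close> decays so fast that the integral over \<open>(d, \<infinity>)\<close> is
  bounded uniformly in \<open>s \<in> [0, 4)\<close>.
\<close>

section \<open>Asymptotics of the numerator at 0 and at infinity\<close>

text \<open>
  This is the numerator of \<open>\<kappa>\<^sub>m\<^sub>m\<close> multiplied by \<open>1 - v\<close>, which clears the inner division, in the
  variable \<open>t = r\<^sup>2\<close>. The powers of \<open>v\<close> are exponentials with a real parameter \<open>c\<close> in place
  of \<open>m\<close>, as \<open>real_asymp\<close> can expand these.
\<close>

definition kappa_num :: "real \<Rightarrow> real \<Rightarrow> real" where
  "kappa_num c t = c * (1 - exp (- ((c + 1) * t))) * (1 - exp (- t)) ^ 2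
     + t * (2 * c + 2) * (exp (- ((c + 1) * t)) - exp (- t)) * (1 - exp (- t))
     + t ^ 2 * ((exp (- ((c + 1) * t)) + exp (- (c * t))) * (1 - exp (- t))
        + ((c + 1) * exp (- t) + 1) * (exp (- t) - exp (- (c * t))))"

text \<open>Each of the three summands has order \<open>t ^ 3\<close> at 0. Orders 3 and 4 cancel in
  the sum, so the coefficient of \<open>t ^ 5\<close> decides.\<close>

lemma kappa_num_at_0:
  assumes "c > 0"
  shows "((\<lambda>t. kappa_num c t / t ^ 5) \<longlongrightarrow> c * (c + 1) / 4) (at_right 0)"
  using assms unfolding kappa_num_def by (real_asymp simp add: power_numeral_reduce field_simps)

lemma kappa_num_at_top:
  assumes "c > 1"
  shows "((\<lambda>t. (kappa_num c t / (c * (1 - exp (- t)) ^ (n + 2)) - 1) * t ^ k) \<longlongrightarrow> 0) at_top"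
proof -
  txt \<open>
    Since \<open>1 - (1 - v)\<^sup>n = v * (\<Sum>i<n. (1 - v)\<^sup>i)\<close>, the whole expression is a combination of terms
    \<open>T j t = t\<^sup>j * v\<close> with coefficients that converge as \<open>v\<close> tends to 0.
  \<close>
  define q :: "real \<Rightarrow> real" where "q = (\<lambda>t. 1 - exp (- t))"
  \<comment> \<open>\<open>u\<close> is what is left of \<open>w\<close> once a factor
    \<open>exp (- t)\<close> is split off; \<open>c > 1\<close> makes it vanish at infinity.\<close>
  define u where "u = (\<lambda>t. exp (- ((c - 1) * t)))"
  define w where "w = (\<lambda>t. exp (- (c * t)))"
  define T :: "nat \<Rightarrow> real \<Rightarrow> real" where "T = (\<lambda>j t. t ^ j / exp t)"
  have T: "(T j \<longlongrightarrow> 0) at_top" for j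
    unfolding T_def by (rule tendsto_power_div_exp_0)
  have v: "((\<lambda>t::real. exp (- t)) \<longlongrightarrow> 0) at_top" by real_asymp
  have q: "(q \<longlongrightarrow> 1) at_top" unfolding q_def by real_asymp
  have u: "(u \<longlongrightarrow> 0) at_top" unfolding u_def using assms by real_asymp
  have w: "(w \<longlongrightarrow> 0) at_top" unfolding w_def using assms by real_asymp
  \<comment> \<open>The main part of the numerator is \<open>c * q t ^ 2\<close>. The first summand
    is its error \<open>1 / q t ^ n - 1\<close>, the second comes from the rest of the numerator;
    both are multiplied by \<open>t ^ k\<close>.\<close>
  have "((\<lambda>t. T k t * (\<Sum>i<n. q t ^ i) / q t ^ n
      + (T k t * (- c * w t * q t ^ 2)
         + T (k + 1) t * ((2 * c + 2) * (w t - 1) * q t)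
         + T (k + 2) t * ((w t + u t) * q t + ((c + 1) * exp (- t) + 1) * (1 - u t)))
        / (c * q t ^ (n + 2))) \<longlongrightarrow>
      0 * (\<Sum>i<n. 1 ^ i) / 1 ^ n
      + (0 * (- c * 0 * 1 ^ 2)
         + 0 * ((2 * c + 2) * (0 - 1) * 1)
         + 0 * ((0 + 0) * 1 + ((c + 1) * 0 + 1) * (1 - 0)))
        / (c * 1 ^ (n + 2))) at_top"
    using assms by (intro tendsto_intros T v q u w) auto
  then have "((\<lambda>t. T k t * (\<Sum>i<n. q t ^ i) / q t ^ n
      + (T k t * (- c * w t * q t ^ 2)
         + T (k + 1) t * ((2 * c + 2) * (w t - 1) * q t)
         + T (k + 2) t * ((w t + u t) * q t + ((c + 1) * exp (- t) + 1) * (1 - u t)))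
        / (c * q t ^ (n + 2))) \<longlongrightarrow> 0) at_top"
    by simp
  moreover have "\<forall>\<^sub>F t in at_top. T k t * (\<Sum>i<n. q t ^ i) / q t ^ n
      + (T k t * (- c * w t * q t ^ 2)
         + T (k + 1) t * ((2 * c + 2) * (w t - 1) * q t)
         + T (k + 2) t * ((w t + u t) * q t + ((c + 1) * exp (- t) + 1) * (1 - u t)))
        / (c * q t ^ (n + 2)) = (kappa_num c t / (c * (1 - exp (- t)) ^ (n + 2)) - 1) * t ^ k"
    using eventually_gt_at_top [of 0]
  proof eventually_elim
    case (elim t)
    define v where "v = exp (- t)"
    define p where "p = q t ^ n"
    have q: "q t > 0" "q t = 1 - v" and p: "p > 0" using elim by (auto simp: q_def v_def p_def)
    have T: "T j t = t ^ j * v" for j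
      by (simp add: T_def v_def exp_minus divide_inverse)
    have w: "w t = v * u t"
      by (simp add: w_def u_def v_def algebra_simps flip: exp_add)
    have S: "v * (\<Sum>i<n. q t ^ i) = 1 - p"
      using one_diff_power_eq [of "q t" n] by (simp add: q p_def)
    have sum: "T k t * (\<Sum>i<n. q t ^ i) = t ^ k * (1 - p)"
      by (simp add: T S [symmetric])
    have "exp (- (c * t)) = w t" "exp (- ((c + 1) * t)) = v * w t"
      by (simp_all add: w_def v_def algebra_simps flip: exp_add)
    then have num: "T k t * (- c * w t * q t ^ 2)
         + T (k + 1) t * ((2 * c + 2) * (w t - 1) * q t)
         + T (k + 2) t * ((w t + u t) * q t + ((c + 1) * v + 1) * (1 - u t))
       = t ^ k * (kappa_num c t - c * q t ^ 2)"
      unfolding kappa_num_def T v_def [symmetric] q(2) [symmetric]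
      by (simp add: w algebra_simps power_add power2_eq_square)
    have "(kappa_num c t / (c * (1 - exp (- t)) ^ (n + 2)) - 1) * t ^ k
        = (kappa_num c t / (c * (p * q t ^ 2)) - 1) * t ^ k"
      by (simp add: p_def q v_def power_add power2_eq_square)
    also have "\<dots> = t ^ k * (1 - p) / p + t ^ k * (kappa_num c t - c * q t ^ 2) / (c * (p * q t ^ 2))"
      using q(1) p assms by (simp add: field_simps)
    finally show ?case
      unfolding v_def [symmetric] sum num by (simp only: p_def power_add)
  qed
  ultimately show ?thesis by (rule Lim_transform_eventually)
qed

section \<open>Transfer from the numerator to the kernel\<close>

lemma kappa_mm_eq:
  assumes "r > 0" "m > 0"
  shows "kappa_mm m r = kappa_num m (r^2) / (m * (1 - exp (- (r^2))) ^ (m + 3))"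
proof -
  define v where "v = exp (- (r^2))"
  define w where "w = v ^ m"
  have v: "1 - v > 0" using assms by (simp add: v_def)
  have w: "exp (- (real m * r^2)) = w" "exp (- ((real m + 1) * r^2)) = v * w"
    by (simp_all add: v_def w_def exp_of_nat_mult [symmetric] exp_add [symmetric] algebra_simps)
  \<comment> \<open>With the inner quotient named \<open>z\<close> and \<open>v - w\<close> replaced
    by \<open>z * (1 - v)\<close>, the claim becomes a polynomial identity.\<close>
  define z where "z = (w - v) / (v - 1)"
  have z: "z * (1 - v) = v - w"
    using v by (simp add: z_def field_simps)
  define N where "N = real m * (1 - v ^ (m + 1)) * (1 - v)
      + r^2 * (2 * real m + 2) * (v ^ (m + 1) - v)
      + r^4 * (v ^ (m + 1) + v ^ m + ((real m + 1) * v + 1) * z)"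
  have "kappa_num m (r^2) = N * (1 - v)"
    unfolding kappa_num_def w v_def [symmetric] N_def
    by (simp add: w_def [symmetric] z [symmetric]) algebra
  moreover have "kappa_mm m r = N / (m * (1 - v) ^ (m + 2))"
    unfolding kappa_mm_def Let_def N_def z_def w_def v_def [symmetric] ..
  moreover have "(1 - v) ^ (m + 3) = (1 - v) ^ (m + 2) * (1 - v)"
    by (simp add: numeral_eq_Suc)
  ultimately show ?thesis
    using v assms(2) by (simp add: v_def [symmetric])
qed

lemma continuous_on_kappa_mm:
  assumes "m > 0"
  shows "continuous_on {0<..} (kappa_mm m)"
  unfolding kappa_mm_def Let_def using assms
  by (auto intro!: continuous_intros)

text \<open>With \<open>t = r^2\<close> the factor \<open>r ^ (2*m) / r ^ 4\<close> is
  \<open>t ^ (m + 3) / t ^ 5\<close>: the power \<open>t ^ (m + 3)\<close> balances the denominator,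
  since \<open>t / (1 - exp (- t))\<close> tends to 1, and \<open>t ^ 5\<close> balances the
  numerator.\<close>

lemma kappa_mm_at_0:
  assumes "m > 0"
  shows "((\<lambda>r. kappa_mm m r * r ^ (2*m) / r ^ 4) \<longlongrightarrow> (real m + 1) / 4) (at_right 0)"
proof -
  have "((\<lambda>t::real. t / (1 - exp (- t))) \<longlongrightarrow> 1) (at_right 0)"
    by real_asymp
  then have "((\<lambda>t. kappa_num m t / t ^ 5 / m * (t / (1 - exp (- t))) ^ (m + 3)) \<longlongrightarrow>
      (real m * (real m + 1) / 4) / m * 1 ^ (m + 3)) (at_right 0)"
    using assms by (intro tendsto_intros kappa_num_at_0) auto
  moreover have "filterlim (\<lambda>r::real. r^2) (at_right 0) (at_right 0)"
    by real_asymp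
  ultimately have "((\<lambda>r. kappa_num m (r^2) / (r^2) ^ 5 / m * (r^2 / (1 - exp (- (r^2)))) ^ (m + 3)) \<longlongrightarrow>
      (real m * (real m + 1) / 4) / m * 1 ^ (m + 3)) (at_right 0)"
    by (rule filterlim_compose)
  moreover have "(real m * (real m + 1) / 4) / m * 1 ^ (m + 3) = (real m + 1) / 4"
    using assms by simp
  ultimately have "((\<lambda>r. kappa_num m (r^2) / (r^2) ^ 5 / m * (r^2 / (1 - exp (- (r^2)))) ^ (m + 3)) \<longlongrightarrow>
      (real m + 1) / 4) (at_right 0)"
    by metis
  moreover have "\<forall>\<^sub>F r in at_right 0. kappa_num m (r^2) / (r^2) ^ 5 / m * (r^2 / (1 - exp (- (r^2)))) ^ (m + 3)
     = kappa_mm m r * r ^ (2*m) / r ^ 4"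
    using eventually_at_right_less [of 0]
  proof eventually_elim
    case (elim r)
    have "r ^ (2 * (m + 3)) = r ^ (2*m) * r ^ 6" by (simp flip: power_add)
    then show ?case using elim assms
      by (simp add: kappa_mm_eq power_divide power_mult [symmetric])
         (simp add: field_simps flip: power_add)
  qed
  ultimately show ?thesis by (rule Lim_transform_eventually)
qed

lemma kappa_mm_at_top:
  assumes "m \<ge> 2"
  shows "((\<lambda>r. (kappa_mm m r - 1) * r ^ (2*m+1)) \<longlongrightarrow> 0) at_top"
proof -
  define F where "F = (\<lambda>t. (kappa_num m t / (m * (1 - exp (- t)) ^ (m + 1 + 2)) - 1) * t ^ (m + 1))"
  have "(F \<longlongrightarrow> 0) at_top"
    unfolding F_def using assms by (intro kappa_num_at_top) auto
  moreover have "filterlim (\<lambda>r::real. r^2) at_top at_top"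
    by real_asymp
  ultimately have "((\<lambda>r. F (r^2)) \<longlongrightarrow> 0) at_top"
    by (rule filterlim_compose)
  \<comment> \<open>In terms of \<open>r\<close>, the factor \<open>t ^ (m + 1)\<close> is
    \<open>r ^ (2*m+2)\<close>, one power too many; \<open>inverse r\<close> removes it.\<close>
  then have "((\<lambda>r. F (r^2) * inverse r) \<longlongrightarrow> 0) at_top"
    using tendsto_inverse_0_at_top [OF filterlim_ident] by (rule tendsto_mult_zero)
  moreover have "\<forall>\<^sub>F r in at_top. F (r^2) * inverse r = (kappa_mm m r - 1) * r ^ (2*m+1)"
    using eventually_gt_at_top [of 0]
  proof eventually_elim
    case (elim r)
    have "(r^2) ^ (m + 1) * inverse r = r ^ (2*m+1)"
      using elim by (simp add: power_mult power2_eq_square field_simps)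
    moreover have "m + 1 + 2 = m + 3" by simp
    ultimately show ?case using elim assms
      by (simp only: F_def kappa_mm_eq mult.assoc)
  qed
  ultimately show ?thesis by (rule Lim_transform_eventually)
qed

section \<open>Positivity of the integral near its pole\<close>

text \<open>Turns gauge integrals of powers into Bochner integrals: nonnegativity makes the former
  absolutely convergent, and Borel measurability allows the passage from the completed measure to
  \<open>lborel\<close>.\<close>

lemma set_integral_lborel_nonneg:
  fixes f :: "'a::euclidean_space \<Rightarrow> real"
  assumes I: "(f has_integral I) A" and nn: "\<And>x. x \<in> A \<Longrightarrow> 0 \<le> f x"
    and [measurable]: "f \<in> borel_measurable borel" "A \<in> sets borel"
  shows "set_integrable lborel A f" "(LINT x:A|lborel. f x) = I"
proof -
  have "f absolutely_integrable_on A"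
    using I nn by (intro nonnegative_absolutely_integrable_1) (auto simp: integrable_on_def)
  then show *: "set_integrable lborel A f"
    unfolding set_integrable_def by (subst (asm) integrable_completion) auto
  show "(LINT x:A|lborel. f x) = I"
    using set_borel_integral_eq_integral(2) [OF *] I by (simp add: integral_unique)
qed

text \<open>The limit bounds \<open>f\<close> beyond some \<open>R\<close>, compactness bounds it on
  \<open>{d..R}\<close>.\<close>

lemma bounded_at_ge_if_tendsto_0:
  fixes f :: "real \<Rightarrow> real"
  assumes "continuous_on {0<..} f" "(f \<longlongrightarrow> 0) at_top" "d > 0"
  obtains M where "M > 0" "\<And>r. r \<ge> d \<Longrightarrow> \<bar>f r\<bar> \<le> M"
proof -
  have "\<forall>\<^sub>F r in at_top. \<bar>f r\<bar> < 1"
    using tendstoD [OF assms(2), of 1] by (simp add: dist_real_def)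
  then obtain R where R: "\<And>r. r \<ge> R \<Longrightarrow> \<bar>f r\<bar> < 1"
    by (auto simp: eventually_at_top_linorder)
  have "continuous_on {d..R} f"
    using assms by (auto intro: continuous_on_subset)
  then have "bounded (f ` {d..R})"
    by (intro compact_imp_bounded compact_continuous_image) auto
  then obtain B where "\<forall>y\<in>f ` {d..R}. norm y \<le> B"
    unfolding bounded_iff by blast
  then have B: "\<And>r. r \<in> {d..R} \<Longrightarrow> \<bar>f r\<bar> \<le> B"
    by simp
  show ?thesis
  proof (rule that [of "max 1 B"])
    fix r assume "r \<ge> d"
    then show "\<bar>f r\<bar> \<le> max 1 B"
      using R [of r] B [of r] by (cases "r \<ge> R") auto
  qed auto
qed

text \<open>The parameter \<open>s\<close> enters only through \<open>r powr (- s)\<close>, so one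
  cut point \<open>d\<close> and the bounds on \<open>h\<close> on either side of it serve all
  \<open>s\<close>.\<close>

lemma integral_powr_pos_near_pole:
  fixes h :: "real \<Rightarrow> real"
  assumes cont: "continuous_on {0<..} h"
    and zero: "((\<lambda>r. h r / r ^ 3) \<longlongrightarrow> L) (at_right 0)" and "L > 0"
    and inf: "((\<lambda>r. h r * r ^ 2) \<longlongrightarrow> 0) at_top"
  shows "\<exists>s0::real. 0 \<le> s0 \<and> s0 < 4 \<and>
    (\<forall>s. s0 \<le> s \<and> s < 4 \<longrightarrow> (LINT r:{0<..}|lborel. h r * r powr (- s)) > 0)"
proof -
  have "\<forall>\<^sub>F r in at_right 0. dist (h r / r ^ 3) L < L / 2"
    using \<open>L > 0\<close> by (intro tendstoD [OF zero]) auto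
  then obtain d0 where d0: "d0 > 0" "\<And>r. 0 < r \<Longrightarrow> r < d0 \<Longrightarrow> dist (h r / r ^ 3) L < L / 2"
    unfolding eventually_at_right_field by blast
  \<comment> \<open>Halving \<open>d0\<close> lets the estimate include \<open>r = d\<close>;
    \<open>d \<le> 1\<close> makes powers of \<open>d\<close> decrease in the exponent, which gives
    bounds uniform in \<open>s\<close>.\<close>
  define d where "d = min 1 (d0 / 2)"
  have d: "0 < d" "d \<le> 1" using d0 by (auto simp: d_def)
  have near: "L / 2 * r ^ 3 \<le> h r \<and> h r \<le> 2 * L * r ^ 3" if "0 < r" "r \<le> d" for r
  proof -
    have "dist (h r / r ^ 3) L < L / 2" using that d0 by (auto simp: d_def)
    then have "L / 2 \<le> h r / r ^ 3" "h r / r ^ 3 \<le> 2 * L"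
      using \<open>L > 0\<close> unfolding dist_real_def by linarith+
    with that show ?thesis by (simp add: field_simps)
  qed
  obtain M where M: "M > 0" "\<And>r. r \<ge> d \<Longrightarrow> \<bar>h r * r ^ 2\<bar> \<le> M"
  proof (rule bounded_at_ge_if_tendsto_0)
    show "continuous_on {0<..} (\<lambda>r. h r * r ^ 2)"
      by (intro continuous_intros cont)
  qed (use inf d in auto)
  \<comment> \<open>\<open>d powr (-4)\<close> bounds \<open>r powr (- s)\<close> for all
    \<open>r > d\<close> and \<open>0 \<le> s < 4\<close>, so \<open>K\<close> does not depend on
    \<open>s\<close>.\<close>
  define K where "K = M * d powr (-4)"
  have K: "K > 0" using M d by (simp add: K_def)
  \<comment> \<open>Chosen so that \<open>4 - s < \<epsilon>\<close> says exactly that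
    \<open>L / 2 * d powr 4 / (4 - s)\<close> exceeds the tail bound \<open>K / d\<close>.\<close>
  define \<epsilon> where "\<epsilon> = L / 2 * d powr 4 / (K / d)"
  have \<epsilon>: "\<epsilon> > 0" using \<open>L > 0\<close> d K by (simp add: \<epsilon>_def)
  \<comment> \<open>Half of \<open>\<epsilon>\<close> keeps the inequality strict at
    \<open>s = s0\<close> itself.\<close>
  define s0 where "s0 = max 0 (4 - \<epsilon> / 2)"
  have "(LINT r:{0<..}|lborel. h r * r powr (- s)) > 0" if s: "s0 \<le> s" "s < 4" for s
  proof -
    define f where "f = (\<lambda>r. h r * r powr (- s))"
    have s': "0 \<le> s" "4 - s < \<epsilon>" using s \<epsilon> by (auto simp: s0_def)
    have "continuous_on {0<..} f" unfolding f_def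
      by (intro continuous_intros cont) auto
    then have meas: "set_borel_measurable lborel {0<..} f"
      using borel_measurable_continuous_on_indicator [of "{0<..}" f]
      by (simp add: set_borel_measurable_def)

    have "((\<lambda>r. r powr (3 - s)) has_integral d powr (3 - s + 1) / (3 - s + 1)) {0..d}"
      using s d by (intro has_integral_powr_from_0) auto
    then have "((\<lambda>r. r powr (3 - s)) has_integral d powr (4 - s) / (4 - s)) {0..d}"
      by simp
    then have "((\<lambda>r. r powr (3 - s)) has_integral d powr (4 - s) / (4 - s)) {0<..d}"
      by (rule iffD1 [OF has_integral_spike_set_eq, rotated -1])
         (auto intro: negligible_subset [of "{0}"])
    note A = set_integral_lborel_nonneg [OF this]
    have "((\<lambda>r. r powr (- 2)) has_integral - (d powr (- 2 + 1)) / (- 2 + 1)) {d..}"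
      using d by (intro has_integral_powr_to_inf) auto
    then have "((\<lambda>r. r powr (- 2)) has_integral 1 / d) {d..}"
      using d by (simp add: powr_minus_divide)
    then have "((\<lambda>r. r powr (- 2)) has_integral 1 / d) {d<..}"
      by (rule iffD1 [OF has_integral_spike_set_eq, rotated -1])
         (auto intro: negligible_subset [of "{d}"])
    note B = set_integral_lborel_nonneg [OF this]

    have fA: "L / 2 * r powr (3 - s) \<le> f r" "f r \<le> 2 * L * r powr (3 - s)" if "r \<in> {0<..d}" for r
    proof -
      have "r powr (3 - s) = r ^ 3 * r powr (- s)"
        using that powr_add [of r 3 "- s"] by simp
      then show "L / 2 * r powr (3 - s) \<le> f r" "f r \<le> 2 * L * r powr (3 - s)"
        using near [of r] that mult_right_mono [of _ _ "r powr (- s)"]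
        by (auto simp: f_def mult.assoc [symmetric])
    qed
    have fB: "\<bar>f r\<bar> \<le> K * r powr (- 2)" if "r \<in> {d<..}" for r
    proof -
      have "\<bar>h r\<bar> \<le> M * r powr (- 2)"
        using M(2) [of r] that d by (simp add: powr_minus_divide abs_mult field_simps)
      moreover have "r powr (- s) \<le> d powr (- s)"
        using that d s' by (intro powr_mono2') auto
      moreover have "d powr (- s) \<le> d powr (- 4)"
        using d s by (intro powr_mono') auto
      ultimately have "\<bar>h r\<bar> * r powr (- s) \<le> (M * r powr (- 2)) * d powr (- 4)"
        using M by (intro mult_mono) auto
      then show ?thesis by (simp add: f_def K_def abs_mult mult_ac)
    qed

    \<comment> \<open>Integrability on both pieces is essential: without it the Bochner integral
      would be 0 by default, and neither comparison nor additivity would apply.\<close>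
    have intA: "set_integrable lborel {0<..d} f"
    proof (rule set_integrable_bound)
      show "set_integrable lborel {0<..d} (\<lambda>r. 2 * L * r powr (3 - s))"
        using A(1) by (intro set_integrable_mult_right) auto
      show "set_borel_measurable lborel {0<..d} f"
        using meas by (rule set_borel_measurable_subset) auto
      show "AE r in lborel. r \<in> {0<..d} \<longrightarrow> norm (f r) \<le> norm (2 * L * r powr (3 - s))"
      proof (intro AE_I2 impI)
        fix r assume r: "r \<in> {0<..d}"
        have "0 \<le> L / 2 * r powr (3 - s)" using \<open>L > 0\<close> by simp
        with fA [OF r] show "norm (f r) \<le> norm (2 * L * r powr (3 - s))"
          unfolding real_norm_def by linarith
      qed
    qed
    have intB: "set_integrable lborel {d<..} f"
    proof (rule set_integrable_bound)
      show "set_integrable lborel {d<..} (\<lambda>r. K * r powr (- 2))"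
        using B(1) by (intro set_integrable_mult_right) auto
      show "set_borel_measurable lborel {d<..} f"
        using meas by (rule set_borel_measurable_subset) (use d in auto)
      show "AE r in lborel. r \<in> {d<..} \<longrightarrow> norm (f r) \<le> norm (K * r powr (- 2))"
        using fB K by (intro AE_I2 impI) (force simp: abs_mult)
    qed
    have "K / d < L / 2 * d powr 4 / (4 - s)"
      using s s' K d \<open>L > 0\<close> unfolding \<epsilon>_def by (simp add: field_simps)
    also have "\<dots> \<le> L / 2 * (d powr (4 - s) / (4 - s))"
    proof -
      have "d powr 4 \<le> d powr (4 - s)" using d s' by (intro powr_mono') auto
      then show ?thesis using \<open>L > 0\<close> s by (simp add: divide_right_mono)
    qed
    also have "\<dots> = (LINT r:{0<..d}|lborel. L / 2 * r powr (3 - s))"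
      using A(2) by simp
    also have "\<dots> \<le> (LINT r:{0<..d}|lborel. f r)"
      using A(1) intA fA by (intro set_integral_mono set_integrable_mult_right) auto
    finally have 1: "K / d < (LINT r:{0<..d}|lborel. f r)" .
    have "- (K / d) = (LINT r:{d<..}|lborel. - K * r powr (- 2))"
      using B(2) by (subst set_integral_mult_right) simp
    also have "\<dots> \<le> (LINT r:{d<..}|lborel. f r)"
    proof (intro set_integral_mono set_integrable_mult_right intB)
      show "- K * r powr (- 2) \<le> f r" if "r \<in> {d<..}" for r
        using fB [OF that] by linarith
    qed (use B(1) in auto)
    finally have 2: "- (K / d) \<le> (LINT r:{d<..}|lborel. f r)" .
    have "{0<..} = {0<..d} \<union> {d<..}" using d by auto
    moreover have "{0<..d} \<inter> {d<..} = {}" by auto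
    ultimately have "(LINT r:{0<..}|lborel. f r) = (LINT r:{0<..d}|lborel. f r) + (LINT r:{d<..}|lborel. f r)"
      using set_integral_Un [OF _ intA intB] by (simp only:)
    with 1 2 show ?thesis by (simp add: f_def)
  qed
  moreover have "0 \<le> s0" "s0 < 4" using \<epsilon> by (auto simp: s0_def)
  ultimately show ?thesis by blast
qed

section \<open>Application to the Riesz coefficient\<close>

theorem proposition1:
  fixes m :: nat
  assumes "m \<ge> 3"
  shows "\<exists>s\<^sub>m::real. 0 \<le> s\<^sub>m \<and> s\<^sub>m < 4 \<and> (\<forall>s::real. s\<^sub>m \<le> s \<and> s < 4 \<longrightarrow> riesz_coeff m s > 0)"
proof -
  define h where "h = (\<lambda>r. (kappa_mm m r - 1) * r ^ (2 * m - 1))"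
  obtain k where k: "m = k + 3" using assms by (metis add.commute le_Suc_ex)
  have "\<exists>s0::real. 0 \<le> s0 \<and> s0 < 4 \<and>
    (\<forall>s. s0 \<le> s \<and> s < 4 \<longrightarrow> (LINT r:{0<..}|lborel. h r * r powr (- s)) > 0)"
  proof (rule integral_powr_pos_near_pole)
    show "continuous_on {0<..} h" unfolding h_def
      using assms by (intro continuous_intros continuous_on_kappa_mm) auto
    show "(real m + 1) / 4 > 0" by simp
    \<comment> \<open>The term \<open>-1\<close> of the integrand contributes
      \<open>r ^ (2 * m - 1) / r ^ 3\<close>, which is \<open>r ^ (2 * k + 2)\<close>; its exponent
      is positive because \<open>m \<ge> 3\<close>.\<close>
    have "((\<lambda>r::real. r ^ (2 * k + 2)) \<longlongrightarrow> 0) (at_right 0)"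
      by (rule tendsto_eq_intros refl | simp)+
    with kappa_mm_at_0 [of m] have "((\<lambda>r. kappa_mm m r * r ^ (2*m) / r ^ 4 - r ^ (2 * k + 2)) \<longlongrightarrow>
        (real m + 1) / 4 - 0) (at_right 0)"
      using assms by (intro tendsto_diff) auto
    then have "((\<lambda>r. kappa_mm m r * r ^ (2*m) / r ^ 4 - r ^ (2 * k + 2)) \<longlongrightarrow>
        (real m + 1) / 4) (at_right 0)"
      by (simp only: diff_0_right)
    moreover have "\<forall>\<^sub>F r in at_right 0. kappa_mm m r * r ^ (2*m) / r ^ 4 - r ^ (2 * k + 2) = h r / r ^ 3"
      using eventually_at_right_less [of 0]
      by eventually_elim (simp add: h_def k field_simps power_add numeral_eq_Suc)
    ultimately show "((\<lambda>r. h r / r ^ 3) \<longlongrightarrow> (real m + 1) / 4) (at_right 0)"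
      by (rule Lim_transform_eventually)
    have "h r * r ^ 2 = (kappa_mm m r - 1) * r ^ (2*m+1)" for r
      by (simp add: h_def k power_add numeral_eq_Suc)
    then show "((\<lambda>r. h r * r ^ 2) \<longlongrightarrow> 0) at_top"
      using kappa_mm_at_top [of m] assms by simp
  qed
  moreover have "riesz_coeff m s = 2 * m * (LINT r:{0<..}|lborel. h r * r powr (- s))" for s
  proof -
    have "(kappa_mm m r - 1) * r powr (2 * real m - 1 - s) = h r * r powr (- s)" if "r > 0" for r
    proof -
      have "r powr (2 * real m - 1 - s) = r powr real (2 * m - 1) * r powr (- s)"
        using assms by (simp add: powr_add [symmetric] of_nat_diff)
      then show ?thesis using that by (simp add: h_def powr_realpow)
    qed
    then show ?thesis unfolding riesz_coeff_def
      by (subst set_lebesgue_integral_cong) auto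
  qed
  ultimately show ?thesis using assms by (simp add: zero_less_mult_iff)
qed

end
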